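(* Let $n\ge 3$ be an integer and let $$\tau=\frac23\log 2-\log(2\pi)-\frac16-\frac1{81}-\frac12 .$$ Then there exist a real number $\epsilon$ with $$0\le\epsilon\le-\frac{6}{\pi^2}\bigl(\log(2n+2)+\tau\bigr)+\frac{6}{\pi^2}\sqrt{\bigl(\log(2n+2)+\tau\bigr)^2+\frac{\pi^2}{3}}$$ and a real number $\sigma\in[-2n-2,\,-2n-2+\epsilon]$ such that $\eta'(\sigma)=0$.
   Context: $\eta$ is the Euler (Dirichlet) eta function, $\eta(s)=\sum_{n\ge 1}(-1)^{n+1}n^{-s}$ for $\Re(s)>0$, extended to an entire function by $\eta(s)=(1-2^{1-s})\zeta(s)$, where $\zeta$ is the Riemann zeta function. $\eta'$ is its derivative. *)

theory Defs
  imports "HOL-Complex_Analysis.Complex_Analysis"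
begin

(* The analytic continuation of the series to the plane without the pole 1.
   The condition f 1 = 0 only fixes the otherwise arbitrary value at the pole, so that f is unique. *)
definition riemann_zeta :: "complex \<Rightarrow> complex" where
  "riemann_zeta = (THE f. f holomorphic_on (- {1}) \<and>
     (\<forall>s. Re s > 1 \<longrightarrow> f s = (\<Sum>k. of_nat (Suc k) powr (- s))) \<and> f 1 = 0)"

(* The summation index is shifted by one (k = n - 1). The series converges only conditionally for
   0 < Re s <= 1; suminf is the limit of its partial sums. On Re s > 0 without the point 1 both
   branches agree, and at 1 the series supplies the value ln 2 of the entire function. *)
definition dirichlet_eta :: "complex \<Rightarrow> complex" where
  "dirichlet_eta s =
     (if Re s > 0 then (\<Sum>k. (-1) ^ k * of_nat (Suc k) powr (- s))
      else (1 - 2 powr (1 - s)) * riemann_zeta s)"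

end

theory Submission imports Defs begin

text \<open>
  Left of the imaginary axis the functional equation turns \<open>\<eta>\<close> into an explicit product: with
  \<open>u = 1 - s\<close>,
  \[ \eta(s) = -2\,(2^u - 1)\,(2\pi)^{-u}\,\Gamma(u)\,\zeta(u)\,\sin(\pi s/2). \]
  Put \<open>N = 2n + 2\<close> and \<open>s = -N + t\<close> with \<open>0 \<le> t < 2\<close>. Up to a sign that does not depend on
  \<open>t\<close>, \<open>\<eta>\<close> is \<open>sin (\<pi>t/2)\<close> times a positive function. It vanishes at \<open>t = 0\<close>, so it has
  a critical point in \<open>[0, \<epsilon>]\<close> as soon as its logarithmic derivative is at most \<open>0\<close> at
  \<open>t = \<epsilon>\<close>. That logarithmic derivative is \<open>(\<pi>/2) cot (\<pi>t/2) - q(u)\<close>, where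
  \[ q(u) = \frac{2^u \log 2}{2^u - 1} - \log(2\pi) + \psi(u) + \frac{\zeta'(u)}{\zeta(u)} . \]

  The bound on \<open>\<epsilon>\<close> in the theorem is the positive root of
  \<open>\<pi>\<^sup>2\<epsilon>\<^sup>2/12 + L\<epsilon> = 1\<close> with \<open>L = log N + \<tau>\<close>, and this root is taken as \<open>\<epsilon>\<close>. The
  inequality \<open>x cot x \<le> 1 - x\<^sup>2/3\<close> (lemma \<open>x_cos_le_sin\<close>) bounds the cotangent term by
  \<open>1/\<epsilon> - \<pi>\<^sup>2\<epsilon>/12 = L\<close>. What remains is \<open>q(u) \<ge> L\<close> for the single value
  \<open>u = N + 1 - \<epsilon>\<close>, and there is plenty of room for it: convexity of \<open>log \<Gamma>\<close> gives
  \<open>\<psi>(u) \<ge> log (u - 1)\<close>, and convexity of \<open>\<zeta>\<close> on the half-line makes \<open>\<zeta>'/\<zeta>\<close> at \<open>u\<close> no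
  smaller than \<open>-1/5\<close>.

  The functional equation itself follows from evaluating one Mellin transform in two ways.
  For \<open>s > 1\<close> the geometric series gives
  \<open>\<integral> t^(s-1) / (exp t - 1) dt = \<Gamma>(s) \<zeta>(s)\<close>. For \<open>-1 < s < 0\<close> the same integral with the
  singular part \<open>1/t - 1/2\<close> of the kernel removed is evaluated through the partial fractions
  \[ \frac{1}{e^t-1} - \frac1t + \frac12 = \sum_{j\ge 1} \frac{2t}{t^2+(2\pi j)^2} \]
  and an Euler beta integral; this produces \<open>\<zeta>(1 - s)\<close>. Only real \<open>s\<close> is needed, where all
  summands are nonnegative, so that sums and integrals may be interchanged freely. Removing the
  singular part only on \<open>(0, 1)\<close> gives one Mellin transform which is holomorphic on
  \<open>Re s > -1\<close> and captures both cases (lemmas \<open>Mellin_bose_cut_right\<close> and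
  \<open>Mellin_bose_cut_left\<close>), and the identity theorem does the rest.
\<close>

section \<open>Partial fractions of the cotangent and of the Bose kernel\<close>

text \<open>
  The logarithmic derivative of the reflection formula \<open>\<Gamma>(z) \<Gamma>(1 - z) sin (\<pi>z) = \<pi>\<close>.
\<close>
lemma Digamma_reflection_complex:
  fixes z :: complex
  assumes "z \<notin> \<int>"
  shows "Digamma (1 - z) - Digamma z = of_real pi * cot (of_real pi * z)"
proof -
  have nz: "z \<notin> \<int>\<^sub>\<le>\<^sub>0" "1 - z \<notin> \<int>\<^sub>\<le>\<^sub>0"
    using assms Ints_diff[of 1 "1 - z"] nonpos_Ints_Int by auto
  have op: "open (- \<int> :: complex set)"
    using closed_Ints by blast
  have sin_nz: "sin (of_real pi * w) \<noteq> 0" if "w \<notin> \<int>" for w :: complex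
    using that by (auto simp: sin_eq_0 mult.commute)
  let ?F = "\<lambda>w. Gamma w * Gamma (1 - w) * sin (of_real pi * w) :: complex"
  have "(?F has_field_derivative 0) (at z)"
  proof (rule has_field_derivative_transform_within_open[of "\<lambda>_. of_real pi" _ _ "- \<int>"])
    fix w :: complex assume "w \<in> - \<int>"
    thus "of_real pi = ?F w"
      using sin_nz[of w] by (simp add: Gamma_reflection_complex)
  qed (use op assms in auto)
  moreover have "(?F has_field_derivative
      ?F z * (Digamma z - Digamma (1 - z) + of_real pi * cot (of_real pi * z))) (at z)"
    using nz sin_nz[OF assms]
    by (auto intro!: derivative_eq_intros simp: cot_def field_simps)
  ultimately have "?F z * (Digamma z - Digamma (1 - z) + of_real pi * cot (of_real pi * z)) = 0"
    using DERIV_unique by blast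
  moreover have "?F z \<noteq> 0"
    using nz sin_nz[OF assms] by (auto simp: Gamma_eq_zero_iff)
  ultimately have "Digamma z - Digamma (1 - z) + of_real pi * cot (of_real pi * z) = 0"
    by (metis mult_eq_0_iff)
  thus ?thesis by (simp add: algebra_simps)
qed

text \<open>
  In the limit formula for \<open>\<psi>\<close>, the logarithms cancel from \<open>\<psi>(1 + z) - \<psi>(1 - z)\<close>. What is
  left is the symmetric sum below, and the reflection formula expresses it by the cotangent.
\<close>
lemma cot_partial_fractions:
  fixes z :: complex
  assumes "z \<notin> \<int>"
  shows "(\<lambda>n. 2 * z / ((of_nat n + 1)^2 - z^2)) sums (1 / z - of_real pi * cot (of_real pi * z))"
proof -
  have nz: "z \<noteq> 0" "1 + z \<noteq> 0" "1 - z \<noteq> 0"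
    using assms Ints_diff[of 1 "1 - z"] Ints_minus[of 1] by (auto simp: add_eq_0_iff)
  have ne: "of_nat n + 1 - z \<noteq> 0" "of_nat n + 1 + z \<noteq> 0" for n
  proof -
    show "of_nat n + 1 - z \<noteq> 0"
      using assms by (metis Ints_1 Ints_add Ints_of_nat eq_iff_diff_eq_0)
    show "of_nat n + 1 + z \<noteq> 0"
      using assms by (metis Ints_1 Ints_add Ints_minus Ints_of_nat add_eq_0_iff)
  qed
  have "(\<lambda>m. (of_real (ln (real m)) - (\<Sum>n<m. inverse (1 + z + of_nat n))) -
             (of_real (ln (real m)) - (\<Sum>n<m. inverse (1 - z + of_nat n))))
        \<longlonglongrightarrow> Digamma (1 + z) - Digamma (1 - z)"
    by (intro tendsto_diff Digamma_LIMSEQ nz)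
  also have "(\<lambda>m. (of_real (ln (real m)) - (\<Sum>n<m. inverse (1 + z + of_nat n))) -
             (of_real (ln (real m)) - (\<Sum>n<m. inverse (1 - z + of_nat n)))) =
        (\<lambda>m. \<Sum>n<m. inverse (1 - z + of_nat n) - inverse (1 + z + of_nat n))"
    by (simp add: sum_subtractf)
  also have "\<dots> = (\<lambda>m. \<Sum>n<m. 2 * z / ((of_nat n + 1)^2 - z^2))"
  proof (intro ext sum.cong refl)
    fix n
    have "(of_nat n + 1)^2 - z^2 = (of_nat n + 1 - z) * (of_nat n + 1 + z)"
      by (simp add: power2_eq_square algebra_simps)
    thus "inverse (1 - z + of_nat n) - inverse (1 + z + of_nat n) = 2 * z / ((of_nat n + 1)^2 - z^2)"
      using ne[of n] by (simp add: field_simps)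
  qed
  also have "Digamma (1 + z) - Digamma (1 - z) = 1 / z - of_real pi * cot (of_real pi * z)"
    using Digamma_plus1[OF nz(1)] Digamma_reflection_complex[OF assms] by (simp add: algebra_simps)
  finally show ?thesis by (simp add: sums_def)
qed

text \<open>
  The cotangent series at the imaginary point \<open>z = \<i>t/(2\<pi>)\<close>, where the cotangent becomes
  \<open>-\<i> coth (t/2) = -\<i> (1 + 2 / (exp t - 1))\<close>.
\<close>
lemma bose_partial_fractions:
  fixes t :: real
  assumes "t > 0"
  shows "(\<lambda>n. 2 * t / (t^2 + (2 * pi * real (Suc n))^2)) sums (1 / (exp t - 1) - 1 / t + 1 / 2)"
proof -
  define y where "y = t / (2 * pi)"
  have y: "y > 0" and t: "t = 2 * pi * y" using assms by (simp_all add: y_def)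
  define z where "z = \<i> * of_real y"
  have z: "z \<notin> \<int>"
  proof
    assume "z \<in> \<int>"
    then have "Im z = 0" by (auto elim!: Ints_cases)
    thus False using y by (simp add: z_def)
  qed

  have cot: "cot (of_real pi * z) = - \<i> * of_real (1 + 2 / (exp t - 1))"
  proof -
    have E: "exp (\<i> * (of_real pi * z)) = of_real (exp (- t / 2))"
            "exp (- (\<i> * (of_real pi * z))) = of_real (exp (t / 2))"
      by (simp_all add: z_def t algebra_simps flip: exp_of_real)
    have h: "exp t = exp (t/2) * exp (t/2)" "exp (-t/2) = inverse (exp (t/2))"
      by (simp_all add: exp_minus flip: exp_add)
    have p: "exp (t/2) > 1" using assms by simp
    have sin: "sin (of_real pi * z) = - \<i> / 2 * of_real (exp (-t/2) - exp (t/2))"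
      unfolding sin_exp_eq E by (simp add: field_simps)
    have cos: "cos (of_real pi * z) = of_real (exp (-t/2) + exp (t/2)) / 2"
      unfolding cos_exp_eq E by simp
    have "cot (of_real pi * z) =
       \<i> * of_real ((exp (-t/2) + exp (t/2)) / (exp (-t/2) - exp (t/2)))"
    proof -
      have "(of_real e / 2) / (- \<i> / 2 * of_real d) = \<i> * complex_of_real (e / d)" for e d :: real
        by (cases "d = 0") (simp_all add: field_simps)
      thus ?thesis unfolding cot_def sin cos by blast
    qed
    also have "(exp (-t/2) + exp (t/2)) / (exp (-t/2) - exp (t/2)) = - (1 + 2 / (exp t - 1))"
    proof -
      define q where "q = exp (t/2)"
      have "q > 1" using p by (simp add: q_def)
      hence "q * q > 1" by (metis less_1_mult)
      thus ?thesis unfolding h(1) h(2) q_def[symmetric] using \<open>q > 1\<close>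
        by (simp add: divide_simps) (simp add: algebra_simps)
    qed
    finally show ?thesis by (simp only: of_real_minus) (simp only: mult_minus_left mult_minus_right)
  qed
  have inv: "1 / z = - \<i> * of_real (1 / y)" using y by (simp add: z_def field_simps)
  have R: "1 / z - of_real pi * cot (of_real pi * z) =
      \<i> * of_real (2 * pi * (1 / (exp t - 1) - 1 / t + 1 / 2))"
  proof -
    have "1 / z - of_real pi * cot (of_real pi * z) = \<i> * of_real (pi * (1 + 2 / (exp t - 1)) - 1 / y)"
      unfolding cot inv of_real_diff of_real_mult by (simp add: algebra_simps)
    also have "pi * (1 + 2 / (exp t - 1)) - 1 / y = 2 * pi * (1 / (exp t - 1) - 1 / t + 1 / 2)"
      using y by (simp add: t ring_distribs)
    finally show ?thesis .
  qed
  have S: "2 * z / ((of_nat n + 1)^2 - z^2) =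
      \<i> * of_real (2 * pi * (2 * t / (t^2 + (2 * pi * real (Suc n))^2)))" for n
  proof -
    have "2 * pi * (2 * t / (t^2 + (2 * pi * real (Suc n))^2)) = 2 * y / ((real n + 1)^2 + y^2)"
    proof -
      have "t^2 + (2 * pi * real (Suc n))^2 = (2 * pi)^2 * ((real n + 1)^2 + y^2)"
        by (simp add: t power2_eq_square algebra_simps)
      thus ?thesis by (simp add: t power2_eq_square)
    qed
    moreover have "(of_nat n + 1)^2 - z^2 = of_real ((real n + 1)^2 + y^2)"
      by (simp add: z_def power_mult_distrib)
    ultimately show ?thesis by (simp only:) (simp add: z_def)
  qed
  have "(\<lambda>n. \<i> * of_real (2 * pi * (2 * t / (t^2 + (2 * pi * real (Suc n))^2)))) sums
        (\<i> * of_real (2 * pi * (1 / (exp t - 1) - 1 / t + 1 / 2)))"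
    using cot_partial_fractions[OF z] unfolding R S .
  hence "(\<lambda>n. Im (\<i> * of_real (2 * pi * (2 * t / (t^2 + (2 * pi * real (Suc n))^2))))) sums
        Im (\<i> * of_real (2 * pi * (1 / (exp t - 1) - 1 / t + 1 / 2)))"
    by (rule sums_Im)
  hence "(\<lambda>n. 2 * pi * (2 * t / (t^2 + (2 * pi * real (Suc n))^2))) sums
        (2 * pi * (1 / (exp t - 1) - 1 / t + 1 / 2))" by simp
  thus ?thesis by (subst (asm) sums_mult_iff) auto
qed

section \<open>Mellin transforms of nonnegative functions\<close>

lemma has_bochner_integral_indicator_if_has_integral:
  fixes f :: "real \<Rightarrow> real"
  assumes "\<And>x. x \<in> \<Omega> \<Longrightarrow> 0 \<le> f x" "(f has_integral I) \<Omega>"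
    and "(\<lambda>x. indicator \<Omega> x * f x) \<in> borel_measurable lborel"
  shows "has_bochner_integral lborel (\<lambda>x. indicator \<Omega> x * f x) I"
proof (rule has_bochner_integral_nn_integral)
  show "I \<ge> 0" using assms(2) by (rule has_integral_nonneg) (use assms(1) in auto)
  show "(\<integral>\<^sup>+ x. ennreal (indicator \<Omega> x * f x) \<partial>lborel) = ennreal I"
    using nn_integral_has_integral_lebesgue[OF assms(1,2)] by simp
qed (use assms in \<open>auto simp: indicator_def\<close>)

text \<open>
  Monotone convergence for series, in the form that delivers both the integrability of the sum
  and the value of its integral.
\<close>
lemma has_bochner_integral_nonneg_sums:
  fixes f :: "nat \<Rightarrow> 'a \<Rightarrow> real"
  assumes f: "\<And>k. has_bochner_integral M (f k) (I k)" and "\<And>k x. 0 \<le> f k x"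
    and F: "\<And>x. (\<lambda>k. f k x) sums F x" and I: "I sums T"
  shows "has_bochner_integral M F T"
proof -
  have int: "integrable M (f k)" and eq: "integral\<^sup>L M (f k) = I k" for k
    using f[of k] by (simp_all add: has_bochner_integral_iff)
  have n: "norm (f k x) = f k x" for k x using assms(2)[of k x] by simp
  have 1: "AE x in M. summable (\<lambda>i. norm (f i x))"
    using sums_summable[OF F] by (simp only: n) simp
  have 2: "summable (\<lambda>i. \<integral>x. norm (f i x) \<partial>M)"
    using sums_summable[OF I] by (simp only: n eq)
  have "F = (\<lambda>x. \<Sum>i. f i x)" using F by (auto simp: sums_iff)
  thus ?thesis
    using integrable_suminf[OF int 1 2] integral_suminf[OF int 1 2] I
    by (simp add: has_bochner_integral_iff eq sums_iff)
qed

lemma has_bochner_integral_Gamma_scaled: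
  fixes s a :: real
  assumes "s > 0" "a > 0"
  shows "has_bochner_integral lborel (\<lambda>t. indicator {0<..} t * (t powr (s - 1) * exp (- (a * t)))) (Gamma s * a powr - s)"
proof -
  have "has_bochner_integral lborel (\<lambda>t. indicator {0..} t * (t powr (s - 1) / exp t)) (Gamma s)"
    by (rule has_bochner_integral_indicator_if_has_integral)
       (use Gamma_integral_real[OF assms(1)] in auto)
  from lborel_has_bochner_integral_real_affine_iff[THEN iffD1, OF _ this, of a 0]
  have "has_bochner_integral lborel (\<lambda>t. indicator {0..} (a * t) * ((a * t) powr (s - 1) / exp (a * t))) (Gamma s / a)"
    using assms by (simp add: field_simps)
  from has_bochner_integral_mult_right[OF this, of "a powr (1 - s)"]
  have "has_bochner_integral lborel (\<lambda>t. a powr (1 - s) * (indicator {0..} (a * t) * ((a * t) powr (s - 1) / exp (a * t))))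
     (a powr (1 - s) * (Gamma s / a))" by simp
  also have "a powr (1 - s) * (Gamma s / a) = Gamma s * a powr - s"
    using assms by (simp add: powr_diff powr_minus field_simps)
  also have "(\<lambda>t. a powr (1 - s) * (indicator {0..} (a * t) * ((a * t) powr (s - 1) / exp (a * t)))) =
     (\<lambda>t. indicator {0<..} t * (t powr (s - 1) * exp (- (a * t))))"
  proof
    fix t :: real
    have "a powr (1 - s) * a powr (s - 1) = 1" using assms by (simp flip: powr_add)
    thus "a powr (1 - s) * (indicator {0..} (a * t) * ((a * t) powr (s - 1) / exp (a * t))) =
      indicator {0<..} t * (t powr (s - 1) * exp (- (a * t)))"
      using assms by (cases "t > 0"; cases "t = 0")
        (auto simp: indicator_def powr_mult exp_minus field_simps zero_le_mult_iff)
  qed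
  finally show ?thesis .
qed

lemma summable_zeta_real:
  assumes "(s::real) > 1"
  shows "summable (\<lambda>k. real (Suc k) powr - s)"
  using assms summable_real_powr_iff[of "-s"] summable_Suc_iff[of "\<lambda>k. real k powr - s"] by simp

text \<open>
  Expand \<open>1 / (exp t - 1)\<close> as the geometric series of the \<open>exp (-(k+1) t)\<close>; each summand is a
  scaled Gamma integral.
\<close>
lemma Mellin_bose:
  fixes s :: real
  assumes "s > 1"
  shows "has_bochner_integral lborel (\<lambda>t. indicator {0<..} t * (t powr (s - 1) / (exp t - 1)))
           (Gamma s * (\<Sum>k. real (Suc k) powr - s))"
proof (rule has_bochner_integral_nonneg_sums)
  fix k
  show "has_bochner_integral lborel (\<lambda>t. indicator {0<..} t * (t powr (s - 1) * exp (- (real (Suc k) * t))))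
     (Gamma s * real (Suc k) powr - s)"
    by (rule has_bochner_integral_Gamma_scaled) (use assms in auto)
next
  fix t :: real
  show "(\<lambda>k. indicator {0<..} t * (t powr (s - 1) * exp (- (real (Suc k) * t)))) sums
        (indicator {0<..} t * (t powr (s - 1) / (exp t - 1)))"
  proof (cases "t > 0")
    case True
    have "(\<lambda>k. exp (-t) * exp (-t) ^ k) sums (exp (-t) * (1 / (1 - exp (-t))))"
      using True by (intro sums_mult geometric_sums) auto
    also have "exp (-t) * (1 / (1 - exp (-t))) = 1 / (exp t - 1)"
      using True by (simp add: exp_minus field_simps)
    also have "(\<lambda>k. exp (-t) * exp (-t) ^ k) = (\<lambda>k. exp (- (real (Suc k) * t)))"
      by (intro ext) (simp add: exp_of_nat_mult [symmetric] algebra_simps flip: exp_add)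
    finally show ?thesis using sums_mult[of _ _ "t powr (s - 1)"] True by fastforce
  qed auto
next
  show "(\<lambda>k. Gamma s * real (Suc k) powr - s) sums (Gamma s * (\<Sum>k. real (Suc k) powr - s))"
    by (intro sums_mult summable_sums summable_zeta_real assms)
qed auto

text \<open>
  The substitution \<open>x = t\<^sup>2/(t\<^sup>2 + a\<^sup>2)\<close> carries the half-line to the unit interval and the beta
  integral with parameters \<open>p = (1 + s)/2\<close> and \<open>q = (1 - s)/2\<close> to a multiple of this one. As
  \<open>p + q = 1\<close>, the reflection formula evaluates the beta function.
\<close>
lemma Mellin_rational:
  fixes s a :: real
  assumes "-1 < s" "s < 0" "a > 0"
  shows "has_bochner_integral lborel (\<lambda>t. indicator {0<..} t * (t powr (s - 1) * (2 * t / (t^2 + a^2))))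
           (a powr (s - 1) * (pi / cos (pi * s / 2)))"
proof (rule has_bochner_integral_indicator_if_has_integral)
  define p q where "p = (1 + s) / 2" and "q = (1 - s) / 2"
  have pq: "p > 0" "q > 0" "p + q = 1" using assms by (simp_all add: p_def q_def field_simps)
  define f where "f = (\<lambda>x::real. x powr (p - 1) * (1 - x) powr (q - 1))"
  define g where "g = (\<lambda>t. t^2 / (t^2 + a^2))"
  define g' where "g' = (\<lambda>t. 2 * t * a^2 / (t^2 + a^2)^2)"
  have pos: "t^2 + a^2 > 0" for t using assms by (simp add: add_nonneg_pos)
  have g1: "1 - g t = a^2 / (t^2 + a^2)" for t
    using less_imp_neq[OF pos[of t]] by (simp only: g_def) (simp add: divide_simps)
  have deriv: "(g has_field_derivative g' t) (at t within S)" for t S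
  proof -
    have "(g has_field_derivative (2 * t * (t^2 + a^2) - t^2 * (2 * t)) / ((t^2 + a^2) * (t^2 + a^2))) (at t within S)"
      unfolding g_def using less_imp_neq[OF pos[of t]]
      by (intro DERIV_divide) (auto intro!: derivative_eq_intros)
    also have "(2 * t * (t^2 + a^2) - t^2 * (2 * t)) / ((t^2 + a^2) * (t^2 + a^2)) = g' t"
      by (simp add: g'_def algebra_simps power2_eq_square)
    finally show ?thesis .
  qed
  have inj: "inj_on g {0<..}"
  proof (rule inj_onI)
    fix x y assume "x \<in> {0<..}" "y \<in> {0<..}" "g x = g y"
    hence "x^2 * a^2 = y^2 * a^2" using pos[of x] pos[of y]
      by (simp add: g_def field_simps)
    thus "x = y" using assms \<open>x \<in> _\<close> \<open>y \<in> _\<close> by (simp add: power2_eq_iff_nonneg)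
  qed
  have img: "g ` {0<..} = {0<..<1}"
  proof (intro equalityI subsetI)
    fix x assume "x \<in> {0<..<1::real}"
    define t where "t = a * sqrt (x / (1 - x))"
    have "t > 0" using \<open>x \<in> _\<close> assms by (simp add: t_def)
    moreover have "t^2 = a^2 * x / (1 - x)" using \<open>x \<in> _\<close> by (simp add: t_def power_mult_distrib)
    hence "g t = x" using \<open>x \<in> _\<close> assms by (simp add: g_def field_simps)
    ultimately show "x \<in> g ` {0<..}" by force
  qed (use assms pos in \<open>auto simp: g_def field_simps\<close>)
  have f_int: "(f has_integral Beta p q) {0<..<1}"
    using has_integral_Beta_real[OF pq(1,2)] by (simp add: has_integral_Icc_iff_Ioo f_def)
  have f_abs: "f absolutely_integrable_on {0<..<1}"
    by (rule nonnegative_absolutely_integrable_1) (use f_int in \<open>auto simp: f_def integrable_on_def\<close>)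
  have "(\<lambda>x. \<bar>g' x\<bar> * f (g x)) absolutely_integrable_on {0<..} \<and>
        integral {0<..} (\<lambda>x. \<bar>g' x\<bar> * f (g x)) = Beta p q"
    using has_absolute_integral_change_of_variables_1'[of "{0<..}" g g' f "Beta p q"]
      deriv inj f_abs f_int unfolding img by auto
  hence *: "((\<lambda>x. \<bar>g' x\<bar> * f (g x)) has_integral Beta p q) {0<..}"
    using set_lebesgue_integral_eq_integral(1) by (auto simp: has_integral_iff)
  have eq: "\<bar>g' t\<bar> * f (g t) = a powr (1 - s) * (t powr (s - 1) * (2 * t / (t^2 + a^2)))"
    if "t \<in> {0<..}" for t
  proof -
    have t: "t > 0" using that by simp
    define D where "D = t^2 + a^2"
    have D: "D > 0" using pos by (simp add: D_def)
    have "f (g t) = (t^2) powr (p - 1) * (a^2) powr (q - 1) / (D powr (p - 1) * D powr (q - 1))"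
      unfolding f_def g1 unfolding g_def D_def[symmetric] using D by (simp add: powr_divide)
    also have "D powr (p - 1) * D powr (q - 1) = D powr (-1)"
      using pq by (simp flip: powr_add)
    also have "\<dots> = 1 / D" using D by (simp add: powr_minus divide_simps)
    also have "(t^2) powr (p - 1) = t powr (s - 1)"
      using t by (simp add: p_def powr_powr diff_divide_distrib flip: powr_numeral)
    also have "(a^2) powr (q - 1) = a powr (1 - s) / a^2"
      using assms by (simp add: q_def powr_powr powr_diff flip: powr_numeral) (simp add: powr_minus divide_simps flip: powr_add)
    finally show ?thesis using t D assms unfolding g'_def D_def[symmetric]
      by (simp add: power2_eq_square field_simps)
  qed
  have "Beta p q = pi / cos (pi * s / 2)"
  proof -
    have q: "q = 1 - p" using pq by simp
    have "complex_of_real (Beta p q) = Gamma (of_real p) * Gamma (1 - of_real p)"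
      by (simp add: Beta_def pq Gamma_complex_of_real[symmetric] q)
    also have "\<dots> = of_real (pi / sin (pi * p))"
      by (simp add: Gamma_reflection_complex flip: sin_of_real)
    finally have "Beta p q = pi / sin (pi * p)" using of_real_eq_iff by blast
    also have "pi * p = pi * s / 2 + pi / 2" by (simp add: p_def field_simps)
    finally show ?thesis by (simp add: sin_add)
  qed
  with * have "((\<lambda>t. a powr (1 - s) * (t powr (s - 1) * (2 * t / (t^2 + a^2)))) has_integral (pi / cos (pi * s / 2))) {0<..}"
    using has_integral_eq[OF eq *] by simp
  from has_integral_mult_right[OF this, of "a powr (s - 1)"]
  show "((\<lambda>t. t powr (s - 1) * (2 * t / (t\<^sup>2 + a\<^sup>2))) has_integral a powr (s - 1) * (pi / cos (pi * s / 2))) {0<..}"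
  proof (rule has_integral_eq[rotated])
    have "a powr (s - 1) * a powr (1 - s) = 1" using assms by (simp flip: powr_add)
    thus "a powr (s - 1) * (a powr (1 - s) * (x powr (s - 1) * (2 * x / (x\<^sup>2 + a\<^sup>2)))) =
       x powr (s - 1) * (2 * x / (x\<^sup>2 + a\<^sup>2))" for x by simp
  qed
qed auto

section \<open>Holomorphy of Mellin transforms\<close>

text \<open>
  Around a point \<open>z\<close> the kernel expands as
  \<open>t^(w-1) = t^(z-1) \<Sum> (ln t)^n (w - z)^n / n!\<close>. Integrating term by term exhibits the transform
  as a convergent power series in \<open>w - z\<close>. The interchange is justified because the absolute
  values of the summands add up to \<open>t^(Re z - 1) exp (\<bar>w - z\<bar> \<bar>ln t\<bar>)\<close>, which for \<open>\<bar>w - z\<bar> < r\<close>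
  is at most \<open>t^(Re z + r - 1) + t^(Re z - r - 1)\<close>.
\<close>
lemma Mellin_transform_holomorphic:
  fixes g :: "real \<Rightarrow> real" and c :: real
  assumes meas: "g \<in> borel_measurable borel"
    and int: "\<And>x. x > c \<Longrightarrow> integrable lborel (\<lambda>t. indicator {0<..} t * (t powr (x - 1) * \<bar>g t\<bar>))"
  shows "(\<lambda>s. LINT t|lborel. indicator {0<..} t *\<^sub>R (of_real t powr (s - 1) * complex_of_real (g t)))
           holomorphic_on {s. Re s > c}" (is "?J holomorphic_on _")
proof -
  have "\<exists>r>0. ?J holomorphic_on ball z r" if z: "Re z > c" for z
  proof -
    \<comment> \<open>Both exponents \<open>Re z - r\<close> and \<open>Re z + r\<close> stay right of \<open>c\<close>, where integrability is assumed.\<close>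
    define r where "r = (Re z - c) / 2"
    have r: "r > 0" "Re z - r > c" "Re z + r > c" using z by (simp_all add: r_def field_simps)
    define A where "A = (\<lambda>n t. indicator {0<..} t *\<^sub>R
        (of_real t powr (z - 1) * of_real (g t) * of_real (ln t ^ n / fact n)))"
    define W where "W = (\<lambda>t. 2 * (indicator {0<..} t * (t powr (Re z - r - 1) * \<bar>g t\<bar>) +
                                    indicator {0<..} t * (t powr (Re z + r - 1) * \<bar>g t\<bar>)))"
    have W: "integrable lborel W" unfolding W_def
      by (intro integrable_mult_right Bochner_Integration.integrable_add int r)
    have "?J holomorphic_on ball z r"
    proof (rule power_series_holomorphic)
      fix w assume w: "w \<in> ball z r"
      define \<rho> where "\<rho> = norm (w - z)"
      have \<rho>: "0 \<le> \<rho>" "\<rho> < r" using w by (simp_all add: \<rho>_def dist_norm norm_minus_commute)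
      define f where "f = (\<lambda>n t. A n t * (w - z) ^ n)"
      have f_sums: "(\<lambda>n. f n t) sums (indicator {0<..} t *\<^sub>R (of_real t powr (w - 1) * of_real (g t)))" for t
      proof (cases "t > 0")
        case True
        have "(\<lambda>n. of_real t powr (z - 1) * of_real (g t) * (((w - z) * of_real (ln t)) ^ n /\<^sub>R fact n)) sums
              (of_real t powr (z - 1) * of_real (g t) * exp ((w - z) * of_real (ln t)))"
          by (intro sums_mult exp_converges)
        also have "(\<lambda>n. of_real t powr (z - 1) * of_real (g t) * (((w - z) * of_real (ln t)) ^ n /\<^sub>R fact n)) = (\<lambda>n. f n t)"
          unfolding power_mult_distrib using True by (simp add: f_def A_def fun_eq_iff scaleR_conv_of_real divide_simps)
        also have "of_real t powr (z - 1) * of_real (g t) * exp ((w - z) * of_real (ln t)) =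
                   of_real t powr (w - 1) * of_real (g t)"
          using True by (simp add: powr_def Ln_of_real algebra_simps flip: exp_add)
        finally show ?thesis using True by simp
      qed (simp add: f_def A_def)
      have norm_sum: "(\<Sum>n<N. norm (f n t)) \<le> W t" for t N
      proof (cases "t > 0")
        case True
        define C where "C = t powr (Re z - 1) * \<bar>g t\<bar>"
        have C: "C \<ge> 0" by (simp add: C_def)
        define u where "u = \<bar>ln t\<bar> * \<rho>"
        have u: "u \<ge> 0" using \<rho> by (simp add: u_def)
        have "norm (f n t) = C * (u ^ n /\<^sub>R fact n)" for n
          using True by (simp add: f_def A_def C_def u_def \<rho>_def norm_mult norm_power norm_divide
              norm_powr_real_powr power_mult_distrib power_abs divide_simps)
        hence "(\<Sum>n<N. norm (f n t)) = C * (\<Sum>n<N. u ^ n /\<^sub>R fact n)"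
          by (simp add: sum_distrib_left)
        also have "(\<Sum>n<N. u ^ n /\<^sub>R fact n) \<le> exp u"
          unfolding exp_def by (intro sum_le_suminf summable_exp_generic) (use u in auto)
        also have "exp u \<le> 2 * (t powr r + t powr - r)"
        proof -
          have "u \<le> \<bar>ln t\<bar> * r" unfolding u_def using \<rho> by (intro mult_left_mono) auto
          hence "exp u \<le> exp (\<bar>ln t\<bar> * r)" by simp
          also have "\<dots> \<le> exp (r * ln t) + exp (- r * ln t)"
            by (cases "ln t \<ge> 0") (simp_all add: mult.commute)
          also have "\<dots> = t powr r + t powr - r" using True by (simp add: powr_def)
          also have "\<dots> \<le> 2 * (t powr r + t powr - r)" by simp
          finally show ?thesis .
        qed
        also have "C * (2 * (t powr r + t powr - r)) = W t"
          using True by (simp add: W_def C_def algebra_simps flip: powr_add)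
        finally show ?thesis using C by (simp add: mult_left_mono)
      next
        case False
        thus ?thesis by (simp add: f_def A_def W_def)
      qed
      have [measurable]: "g \<in> borel_measurable borel" by (fact meas)
      have [measurable]: "f n \<in> borel_measurable lborel" for n
        unfolding f_def A_def by measurable
      have f_le: "norm (f n t) \<le> W t" for n t
      proof -
        have "norm (f n t) \<le> (\<Sum>i<Suc n. norm (f i t))"
          by (rule member_le_sum) auto
        also have "\<dots> \<le> W t" by (rule norm_sum)
        finally show ?thesis .
      qed
      have f_int: "integrable lborel (f n)" for n
      proof (rule Bochner_Integration.integrable_bound[OF W])
        show "AE t in lborel. norm (f n t) \<le> norm (W t)"
          by (intro AE_I2) (metis abs_ge_self f_le order_trans real_norm_def)
      qed measurable
      have "(\<lambda>n. integral\<^sup>L lborel (f n)) sums (\<integral>t. (\<Sum>n. f n t) \<partial>lborel)"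
      proof (rule sums_integral[OF f_int])
        show "AE t in lborel. summable (\<lambda>n. norm (f n t))"
          by (intro AE_I2 summableI_nonneg_bounded[OF _ norm_sum]) auto
        show "summable (\<lambda>n. \<integral>t. norm (f n t) \<partial>lborel)"
        proof (rule summableI_nonneg_bounded)
          fix N
          have "(\<Sum>n<N. \<integral>t. norm (f n t) \<partial>lborel) = (\<integral>t. (\<Sum>n<N. norm (f n t)) \<partial>lborel)"
            using f_int by (subst Bochner_Integration.integral_sum) auto
          also have "\<dots> \<le> integral\<^sup>L lborel W"
            using f_int W norm_sum by (intro integral_mono) auto
          finally show "(\<Sum>n<N. \<integral>t. norm (f n t) \<partial>lborel) \<le> integral\<^sup>L lborel W" .
        qed auto
      qed
      also have "(\<lambda>n. integral\<^sup>L lborel (f n)) = (\<lambda>n. integral\<^sup>L lborel (A n) * (w - z) ^ n)"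
        unfolding f_def by simp
      also have "(\<lambda>t. \<Sum>n. f n t) = (\<lambda>t. indicator {0<..} t *\<^sub>R (of_real t powr (w - 1) * of_real (g t)))"
        using f_sums by (auto simp: sums_iff)
      finally show "(\<lambda>n. integral\<^sup>L lborel (A n) * (w - z) ^ n) sums ?J w" .
    qed
    with r show ?thesis by blast
  qed
  hence "?J analytic_on {s. Re s > c}" by (auto simp: analytic_on_def)
  thus ?thesis by (rule analytic_imp_holomorphic)
qed

section \<open>The functional equation of the zeta function\<close>

text \<open>
  The identity theorem in the form used below, where all explicit evaluations are for real
  arguments only.
\<close>
lemma holomorphic_eq_if_eq_on_real_interval:
  fixes f g :: "complex \<Rightarrow> complex"
  assumes "f holomorphic_on S" "g holomorphic_on S" "open S" "connected S"
    and "a < b" "\<And>x. a < x \<Longrightarrow> x < b \<Longrightarrow> complex_of_real x \<in> S"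
    and eq: "\<And>x. a < x \<Longrightarrow> x < b \<Longrightarrow> f (of_real x) = g (of_real x)"
    and "w \<in> S"
  shows "f w = g w"
proof -
  define m where "m = (a + b) / 2"
  have m: "a < m" "m < b" using \<open>a < b\<close> by (simp_all add: m_def)
  have "f w - g w = 0"
  proof (rule analytic_continuation[of "\<lambda>z. f z - g z" S "of_real ` {a<..<b}" "of_real m"])
    show "complex_of_real m islimpt of_real ` {a<..<b}"
      unfolding islimpt_approachable
    proof (intro allI impI)
      fix e :: real assume "e > 0"
      define x where "x = m + min (e / 2) ((b - m) / 2)"
      have "x \<in> {a<..<b}" "x \<noteq> m" "\<bar>x - m\<bar> < e" using \<open>e > 0\<close> m
        by (auto simp: x_def min_def field_simps)
      thus "\<exists>x'\<in>complex_of_real ` {a<..<b}. x' \<noteq> of_real m \<and> dist x' (of_real m) < e"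
        by (intro bexI[of _ "of_real x"]) (auto simp: dist_norm norm_of_real simp flip: of_real_diff)
    qed
  qed (use assms m in \<open>auto intro!: holomorphic_intros\<close>)
  thus ?thesis by simp
qed

definition zeta_series :: "complex \<Rightarrow> complex" where
  "zeta_series s = (\<Sum>k. of_nat (Suc k) powr (- s))"

definition zeta_real :: "real \<Rightarrow> real" where
  "zeta_real s = (\<Sum>k. real (Suc k) powr - s)"

lemma zeta_series_of_real:
  assumes "s > 1"
  shows "zeta_series (of_real s) = of_real (zeta_real s)"
proof -
  have "of_nat (Suc k) powr (- complex_of_real s) = of_real (real (Suc k) powr - s)" for k
    using powr_of_real[of "real (Suc k)" "-s"] by simp
  thus ?thesis unfolding zeta_series_def zeta_real_def
    using suminf_of_real[OF summable_zeta_real[OF assms], where 'a = complex] by simp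
qed

lemma zeta_series_holomorphic: "zeta_series holomorphic_on {s. Re s > 1}"
proof (rule holomorphic_uniform_sequence)
  show "open {s. 1 < Re s}" by (rule open_halfspace_Re_gt)
  show "(\<lambda>s. \<Sum>k<n. of_nat (Suc k) powr (- s) :: complex) holomorphic_on {s. 1 < Re s}" for n
    by (intro holomorphic_intros)
next
  fix x assume "x \<in> {s. 1 < Re s}"
  define d where "d = (Re x - 1) / 2"
  have d: "d > 0" "Re x - d > 1" using \<open>x \<in> _\<close> by (simp_all add: d_def field_simps)
  have le: "Re x - d \<le> Re w" if "w \<in> cball x d" for w
    using that abs_Re_le_cmod[of "x - w"] by (auto simp: dist_norm)
  have "uniform_limit (cball x d) (\<lambda>n s. \<Sum>k<n. of_nat (Suc k) powr (- s)) zeta_series sequentially"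
    unfolding zeta_series_def
  proof (rule Weierstrass_m_test[OF _ summable_zeta_real[OF d(2)]])
    fix k w assume "w \<in> cball x d"
    have "norm (of_nat (Suc k) powr - w :: complex) = real (Suc k) powr - Re w"
      using norm_powr_real_powr[of "of_nat (Suc k)" "-w"] by simp
    also have "\<dots> \<le> real (Suc k) powr - (Re x - d)"
      using le[OF \<open>w \<in> _\<close>] by (intro powr_mono) auto
    finally show "norm (of_nat (Suc k) powr - w :: complex) \<le> real (Suc k) powr - (Re x - d)" .
  qed
  thus "\<exists>d>0. cball x d \<subseteq> {s. 1 < Re s} \<and>
      uniform_limit (cball x d) (\<lambda>n s. \<Sum>k<n. of_nat (Suc k) powr - s) zeta_series sequentially"
    using d le by (intro exI[of _ d]) force
qed

lemma has_bochner_integral_powr_Ioo: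
  assumes "(a :: real) > -1"
  shows "has_bochner_integral lborel (\<lambda>t. indicator {0<..<1} t * t powr a) (1 / (a + 1))"
  by (rule has_bochner_integral_indicator_if_has_integral)
     (use has_integral_powr_from_0[of a 1] assms in \<open>auto simp: has_integral_Icc_iff_Ioo\<close>)

lemma has_bochner_integral_powr_Ici:
  assumes "(a :: real) < -1"
  shows "has_bochner_integral lborel (\<lambda>t. indicator {1..} t * t powr a) (- 1 / (a + 1))"
  by (rule has_bochner_integral_indicator_if_has_integral)
     (use has_integral_powr_to_inf[of a 1] assms in auto)

definition bose_regular :: "real \<Rightarrow> real" where
  "bose_regular t = 1 / (exp t - 1) - 1 / t + 1 / 2"

text \<open>
  Removing the singular part \<open>1/t - 1/2\<close> on \<open>(0, 1)\<close> alone keeps the exponential decay at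
  infinity, so the Mellin transform of this function converges for all \<open>Re s > -1\<close>. It
  differs from the kernel \<open>1 / (exp t - 1)\<close> by \<open>1/t - 1/2\<close> on \<open>(0, 1)\<close>, and from
  \<open>bose_regular\<close> by \<open>1/t - 1/2\<close> on \<open>[1, \<infinity>)\<close>. The Mellin transforms of these two
  pieces, for \<open>s > 1\<close> and for \<open>s < 0\<close>, are the same rational function of \<open>s\<close> up to sign.
\<close>
definition bose_cut :: "real \<Rightarrow> real" where
  "bose_cut t = (if t < 1 then bose_regular t else 1 / (exp t - 1))"

text \<open>
  Each partial fraction contributes a multiple of \<open>(2\<pi>j)^(s-1)\<close>; summed over \<open>j\<close> these powers
  are the values of \<open>\<zeta>\<close> at \<open>1 - s\<close>. This is where the reflection of \<open>s\<close> comes from.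
\<close>
lemma Mellin_bose_regular:
  fixes s :: real
  assumes "-1 < s" "s < 0"
  shows "has_bochner_integral lborel (\<lambda>t. indicator {0<..} t * (t powr (s - 1) * bose_regular t))
           ((2 * pi) powr (s - 1) * (pi / cos (pi * s / 2)) * zeta_real (1 - s))"
proof (rule has_bochner_integral_nonneg_sums)
  show "has_bochner_integral lborel
     (\<lambda>t. indicator {0<..} t * (t powr (s - 1) * (2 * t / (t^2 + (2 * pi * real (Suc k))^2))))
     ((2 * pi * real (Suc k)) powr (s - 1) * (pi / cos (pi * s / 2)))" for k
    by (rule Mellin_rational) (use assms in auto)
  show "(\<lambda>k. indicator {0<..} t * (t powr (s - 1) * (2 * t / (t^2 + (2 * pi * real (Suc k))^2)))) sums
     (indicator {0<..} t * (t powr (s - 1) * bose_regular t))" for t :: real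
    using sums_mult[OF bose_partial_fractions[of t], of "t powr (s - 1)"]
    by (cases "t > 0") (auto simp: bose_regular_def)
  have "(\<lambda>k. (2 * pi) powr (s - 1) * (pi / cos (pi * s / 2)) * real (Suc k) powr - (1 - s)) sums
     ((2 * pi) powr (s - 1) * (pi / cos (pi * s / 2)) * zeta_real (1 - s))"
    unfolding zeta_real_def by (intro sums_mult summable_sums summable_zeta_real) (use assms in auto)
  thus "(\<lambda>k. (2 * pi * real (Suc k)) powr (s - 1) * (pi / cos (pi * s / 2))) sums
     ((2 * pi) powr (s - 1) * (pi / cos (pi * s / 2)) * zeta_real (1 - s))"
    by (simp add: powr_mult mult_ac del: of_nat_Suc)
qed (auto simp: indicator_def intro!: divide_nonneg_nonneg)

lemma bose_regular_nonneg: "t > 0 \<Longrightarrow> bose_regular t \<ge> 0"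
  unfolding bose_regular_def by (rule sums_le[OF _ sums_zero bose_partial_fractions]) auto

lemma bose_cut_nonneg: "t > 0 \<Longrightarrow> bose_cut t \<ge> 0"
  using bose_regular_nonneg by (simp add: bose_cut_def)

lemma bose_cut_measurable [measurable]: "bose_cut \<in> borel_measurable borel"
  unfolding bose_cut_def bose_regular_def by measurable

lemma Mellin_bose_cut_right:
  fixes s :: real
  assumes "s > 1"
  shows "has_bochner_integral lborel (\<lambda>t. indicator {0<..} t * (t powr (s - 1) * bose_cut t))
           (Gamma s * zeta_real s - 1 / (s - 1) + 1 / (2 * s))"
proof -
  have "has_bochner_integral lborel
     (\<lambda>t. indicator {0<..} t * (t powr (s - 1) / (exp t - 1)) - indicator {0<..<1} t * t powr (s - 2)
          + 1 / 2 * (indicator {0<..<1} t * t powr (s - 1)))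
     (Gamma s * zeta_real s - 1 / ((s - 2) + 1) + 1 / 2 * (1 / ((s - 1) + 1)))"
    unfolding zeta_real_def using assms
    by (intro has_bochner_integral_add has_bochner_integral_diff has_bochner_integral_mult_right
              Mellin_bose has_bochner_integral_powr_Ioo) auto
  also have "(\<lambda>t. indicator {0<..} t * (t powr (s - 1) / (exp t - 1)) - indicator {0<..<1} t * t powr (s - 2)
          + 1 / 2 * (indicator {0<..<1} t * t powr (s - 1))) =
       (\<lambda>t. indicator {0<..} t * (t powr (s - 1) * bose_cut t))"
  proof
    fix t :: real
    show "indicator {0<..} t * (t powr (s - 1) / (exp t - 1)) - indicator {0<..<1} t * t powr (s - 2)
          + 1 / 2 * (indicator {0<..<1} t * t powr (s - 1)) =
        indicator {0<..} t * (t powr (s - 1) * bose_cut t)"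
    proof (cases "0 < t \<and> t < 1")
      case True
      hence "t powr (s - 2) = t powr (s - 1) / t" by (simp add: powr_diff power2_eq_square)
      thus ?thesis using True by (simp add: bose_cut_def bose_regular_def algebra_simps)
    qed (auto simp: bose_cut_def indicator_def)
  qed
  finally show ?thesis by simp
qed

text \<open>
  The two corrections \<open>- 1/(s - 1) + 1/(2s)\<close> are literally those of
  \<open>Mellin_bose_cut_right\<close>; this is what lets a single formula continue \<open>\<zeta>\<close> across
  the strip \<open>0 \<le> Re s \<le> 1\<close>.
\<close>
lemma Mellin_bose_cut_left:
  fixes s :: real
  assumes "-1 < s" "s < 0"
  shows "has_bochner_integral lborel (\<lambda>t. indicator {0<..} t * (t powr (s - 1) * bose_cut t))
           ((2 * pi) powr (s - 1) * (pi / cos (pi * s / 2)) * zeta_real (1 - s) - 1 / (s - 1) + 1 / (2 * s))"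
proof -
  have "has_bochner_integral lborel
     (\<lambda>t. indicator {0<..} t * (t powr (s - 1) * bose_regular t) + indicator {1..} t * t powr (s - 2)
          - 1 / 2 * (indicator {1..} t * t powr (s - 1)))
     ((2 * pi) powr (s - 1) * (pi / cos (pi * s / 2)) * zeta_real (1 - s)
        + - 1 / ((s - 2) + 1) - 1 / 2 * (- 1 / ((s - 1) + 1)))"
    using assms
    by (intro has_bochner_integral_add has_bochner_integral_diff has_bochner_integral_mult_right
              Mellin_bose_regular has_bochner_integral_powr_Ici) auto
  also have "(\<lambda>t. indicator {0<..} t * (t powr (s - 1) * bose_regular t) + indicator {1..} t * t powr (s - 2)
          - 1 / 2 * (indicator {1..} t * t powr (s - 1))) =
       (\<lambda>t. indicator {0<..} t * (t powr (s - 1) * bose_cut t))"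
  proof
    fix t :: real
    show "indicator {0<..} t * (t powr (s - 1) * bose_regular t) + indicator {1..} t * t powr (s - 2)
          - 1 / 2 * (indicator {1..} t * t powr (s - 1)) =
        indicator {0<..} t * (t powr (s - 1) * bose_cut t)"
    proof (cases "t \<ge> 1")
      case True
      hence "t powr (s - 2) = t powr (s - 1) / t" by (simp add: powr_diff power2_eq_square)
      thus ?thesis using True by (simp add: bose_cut_def bose_regular_def algebra_simps)
    qed (auto simp: bose_cut_def indicator_def)
  qed
  finally show ?thesis by simp
qed

text \<open>
  On the half-line \<open>t^(x-1)\<close> is at most the sum of two powers with exponents in the ranges where
  the transform has already been computed, so integrability is inherited from there.
\<close>
lemma integrable_bose_cut:
  fixes x :: real
  assumes "x > -1"
  shows "integrable lborel (\<lambda>t. indicator {0<..} t * (t powr (x - 1) * \<bar>bose_cut t\<bar>))"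
proof -
  \<comment> \<open>\<open>p\<close> lies in the range of \<open>Mellin_bose_cut_left\<close>, \<open>q\<close> in that of \<open>Mellin_bose_cut_right\<close>.\<close>
  define p q where "p = min x (-1/2)" and "q = max x 2"
  have int: "integrable lborel (\<lambda>t. indicator {0<..} t * (t powr (p - 1) * bose_cut t) +
                         indicator {0<..} t * (t powr (q - 1) * bose_cut t))"
    using Mellin_bose_cut_left[of p] Mellin_bose_cut_right[of q] assms
    by (intro Bochner_Integration.integrable_add) (auto simp: has_bochner_integral_iff p_def q_def)
  show ?thesis
  proof (rule Bochner_Integration.integrable_bound[OF int])
    show "AE t in lborel. norm (indicator {0<..} t * (t powr (x - 1) * \<bar>bose_cut t\<bar>)) \<le>
      norm (indicator {0<..} t * (t powr (p - 1) * bose_cut t) + indicator {0<..} t * (t powr (q - 1) * bose_cut t))"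
    proof (intro AE_I2)
      fix t :: real
      show "norm (indicator {0<..} t * (t powr (x - 1) * \<bar>bose_cut t\<bar>)) \<le>
        norm (indicator {0<..} t * (t powr (p - 1) * bose_cut t) + indicator {0<..} t * (t powr (q - 1) * bose_cut t))"
      proof (cases "t > 0")
        case True
        have "t powr (x - 1) \<le> t powr (p - 1) + t powr (q - 1)"
        proof (cases "t \<ge> 1")
          case True
          hence "t powr (x - 1) \<le> t powr (q - 1)" by (intro powr_mono) (auto simp: q_def)
          thus ?thesis by (simp add: add_increasing)
        next
          case False
          hence "t powr (x - 1) \<le> t powr (p - 1)" using \<open>t > 0\<close>
            by (intro powr_mono') (auto simp: p_def)
          thus ?thesis by (simp add: add_increasing2)
        qed
        thus ?thesis using True bose_cut_nonneg[OF True]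
          by (simp add: mult_right_mono flip: distrib_right)
      qed auto
    qed
  qed auto
qed

definition bose_Mellin :: "complex \<Rightarrow> complex" where
  "bose_Mellin s = (LINT t|lborel. indicator {0<..} t *\<^sub>R (of_real t powr (s - 1) * complex_of_real (bose_cut t)))"

lemma bose_Mellin_holomorphic: "bose_Mellin holomorphic_on {s. Re s > -1}"
  unfolding bose_Mellin_def
  by (rule Mellin_transform_holomorphic) (auto intro: integrable_bose_cut)

lemma bose_Mellin_of_real:
  assumes "has_bochner_integral lborel (\<lambda>t. indicator {0<..} t * (t powr (s - 1) * bose_cut t)) I"
  shows "bose_Mellin (of_real s) = of_real I"
proof -
  have "(\<lambda>t. indicator {0<..} t *\<^sub>R (of_real t powr (of_real s - 1) * complex_of_real (bose_cut t))) =
    (\<lambda>t. complex_of_real (indicator {0<..} t * (t powr (s - 1) * bose_cut t)))"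
  proof
    fix t :: real
    show "indicator {0<..} t *\<^sub>R (of_real t powr (of_real s - 1) * complex_of_real (bose_cut t)) =
      complex_of_real (indicator {0<..} t * (t powr (s - 1) * bose_cut t))"
      using powr_of_real[of t "s - 1"] by (cases "t > 0") (auto simp: scaleR_conv_of_real)
  qed
  thus ?thesis using assms
    by (simp only: bose_Mellin_def has_bochner_integral_iff integral_complex_of_real)
qed

text \<open>
  The continuation of \<open>\<zeta>\<close> to \<open>Re s > -1\<close>: the transform of \<open>bose_cut\<close> with its two corrections
  undone, divided by \<open>\<Gamma>(s)\<close>. The pole of \<open>1/(2s)\<close> at \<open>0\<close> is cancelled by the zero of \<open>1/\<Gamma>\<close>,
  so \<open>rGamma s / (2 s)\<close> is written as \<open>rGamma (s + 1) / 2\<close>.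
\<close>
definition zeta_Mellin :: "complex \<Rightarrow> complex" where
  "zeta_Mellin s = rGamma s * (bose_Mellin s + 1 / (s - 1)) - rGamma (s + 1) / 2"

text \<open>
  The right-hand side of the functional equation, holomorphic on \<open>Re s < 0\<close>.
\<close>
definition zeta_reflected :: "complex \<Rightarrow> complex" where
  "zeta_reflected s = 2 * of_real (2 * pi) powr (s - 1) * sin (of_real pi * s / 2) * Gamma (1 - s) * zeta_series (1 - s)"

lemma zeta_Mellin_holomorphic: "zeta_Mellin holomorphic_on {s. Re s > -1} - {1}"
  unfolding zeta_Mellin_def
  by (intro holomorphic_intros holomorphic_on_subset[OF bose_Mellin_holomorphic]) auto

lemma zeta_reflected_holomorphic: "zeta_reflected holomorphic_on {s. Re s < 0}"
proof -
  have "(\<lambda>s. zeta_series (1 - s)) holomorphic_on {s. Re s < 0}"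
    using holomorphic_on_compose_gen[OF _ zeta_series_holomorphic, of "\<lambda>s. 1 - s" "{s. Re s < 0}"]
    by (force simp: o_def intro!: holomorphic_intros)
  moreover have "1 - s \<notin> \<int>\<^sub>\<le>\<^sub>0" if "Re s < 0" for s
    using that by (auto elim!: nonpos_Ints_cases simp: complex_eq_iff)
  ultimately show ?thesis unfolding zeta_reflected_def
    by (intro holomorphic_intros) auto
qed

lemma zeta_Mellin_of_real:
  assumes "s \<noteq> 0" "has_bochner_integral lborel (\<lambda>t. indicator {0<..} t * (t powr (s - 1) * bose_cut t))
    (I - 1 / (s - 1) + 1 / (2 * s))"
  shows "zeta_Mellin (of_real s) = rGamma (of_real s) * of_real I"
proof -
  have r: "rGamma (complex_of_real s) = of_real s * rGamma (of_real s + 1)"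
    by (simp add: rGamma_plus1)
  have "rGamma (of_real s) / (2 * complex_of_real s) = rGamma (of_real s + 1) / 2"
    unfolding r using assms(1) by simp
  thus ?thesis unfolding zeta_Mellin_def bose_Mellin_of_real[OF assms(2)]
    by (simp add: algebra_simps)
qed

lemma rGamma_times_Gamma_of_real:
  assumes "x > 0"
  shows "rGamma (complex_of_real x) * Gamma (of_real x) = 1"
proof -
  have "rGamma x * Gamma x = 1" using Gamma_real_pos[OF assms] by (simp add: rGamma_inverse_Gamma)
  thus ?thesis by (simp add: rGamma_complex_of_real Gamma_complex_of_real flip: of_real_mult)
qed

lemma zeta_Mellin_eq_series:
  assumes "Re s > 1"
  shows "zeta_Mellin s = zeta_series s"
proof (rule holomorphic_eq_if_eq_on_real_interval[of zeta_Mellin "{s. Re s > 1}" zeta_series 1 2 s])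
  show "zeta_Mellin (of_real x) = zeta_series (of_real x)" if "1 < x" "x < 2" for x
  proof -
    have "rGamma (complex_of_real x) * Gamma (of_real x) = 1"
      using that by (intro rGamma_times_Gamma_of_real) auto
    thus ?thesis using that zeta_Mellin_of_real[OF _ Mellin_bose_cut_right[of x]]
      by (simp add: zeta_series_of_real Gamma_complex_of_real)
  qed
qed (use assms in \<open>auto intro!: holomorphic_on_subset[OF zeta_Mellin_holomorphic] zeta_series_holomorphic
        open_halfspace_Re_gt convex_connected convex_halfspace_Re_gt\<close>)

lemma zeta_Mellin_eq_reflected:
  assumes "-1 < Re s" "Re s < 0"
  shows "zeta_Mellin s = zeta_reflected s"
proof (rule holomorphic_eq_if_eq_on_real_interval
    [of zeta_Mellin "{s. Re s > -1} \<inter> {s. Re s < 0}" zeta_reflected "-1" 0 s])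
  show "zeta_Mellin (of_real x) = zeta_reflected (of_real x)" if x: "-1 < x" "x < 0" for x
  proof -
    have c: "cos (pi * x / 2) > 0"
      using x mult_strict_left_mono[OF x(1) pi_gt_zero] by (intro cos_gt_zero_pi) (auto simp: mult_pos_neg)
    have "rGamma (complex_of_real x) = sin (of_real (pi * x)) / of_real pi * Gamma (1 - of_real x)"
    proof -
      have "rGamma (1 - complex_of_real x) * Gamma (1 - of_real x) = 1"
        using x rGamma_times_Gamma_of_real[of "1 - x"] by simp
      hence "rGamma (complex_of_real x) =
          rGamma (of_real x) * rGamma (1 - of_real x) * Gamma (1 - of_real x)" by simp
      thus ?thesis by (simp only: rGamma_reflection_complex of_real_mult)
    qed
    also have "sin (complex_of_real (pi * x)) = of_real (2 * sin (pi * x / 2) * cos (pi * x / 2))"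
      using sin_double[of "pi * x / 2"] by (simp add: sin_of_real del: of_real_mult)
    finally have R: "rGamma (complex_of_real x) =
        of_real (2 * sin (pi * x / 2) * cos (pi * x / 2) / pi * Gamma (1 - x))"
      by (simp flip: Gamma_complex_of_real)
    have "zeta_Mellin (of_real x) = of_real (2 * sin (pi * x / 2) * cos (pi * x / 2) / pi * Gamma (1 - x) *
        ((2 * pi) powr (x - 1) * (pi / cos (pi * x / 2)) * zeta_real (1 - x)))"
      using zeta_Mellin_of_real[OF _ Mellin_bose_cut_left[of x]] x R by simp
    also have "2 * sin (pi * x / 2) * cos (pi * x / 2) / pi * Gamma (1 - x) *
        ((2 * pi) powr (x - 1) * (pi / cos (pi * x / 2)) * zeta_real (1 - x)) =
        2 * (2 * pi) powr (x - 1) * sin (pi * x / 2) * Gamma (1 - x) * zeta_real (1 - x)"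
      using c by (simp add: field_simps)
    also have "complex_of_real \<dots> = zeta_reflected (of_real x)"
      using zeta_series_of_real[of "1 - x"] powr_of_real[of "2 * pi" "x - 1"] Gamma_complex_of_real[of "1 - x"]
        sin_of_real[of "pi * x / 2", where 'a = complex] x
      by (simp add: zeta_reflected_def)
    finally show ?thesis .
  qed
qed (use assms in \<open>auto intro!: holomorphic_on_subset[OF zeta_Mellin_holomorphic] holomorphic_on_subset[OF zeta_reflected_holomorphic]
        open_halfspace_Re_gt open_halfspace_Re_lt convex_connected convex_Int convex_halfspace_Re_gt convex_halfspace_Re_lt\<close>)

text \<open>
  The half-plane \<open>Re s > 1\<close> is a nonempty open part of the connected punctured plane, so
  a function with the three defining properties is unique.
\<close>
lemma riemann_zeta_eqI:
  assumes "f holomorphic_on - {1}" "\<And>s. Re s > 1 \<Longrightarrow> f s = zeta_series s" "f 1 = 0"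
  shows "riemann_zeta = f"
  unfolding riemann_zeta_def
proof (rule the_equality)
  show "f holomorphic_on - {1} \<and> (\<forall>s. 1 < Re s \<longrightarrow> f s = (\<Sum>k. of_nat (Suc k) powr - s)) \<and> f 1 = 0"
    using assms by (auto simp: zeta_series_def)
next
  fix g :: "complex \<Rightarrow> complex"
  assume g: "g holomorphic_on - {1} \<and> (\<forall>s. 1 < Re s \<longrightarrow> g s = (\<Sum>k. of_nat (Suc k) powr - s)) \<and> g 1 = 0"
  show "g = f"
  proof
    fix z
    show "g z = f z"
    proof (cases "z = 1")
      case False
      show ?thesis
      proof (rule analytic_continuation_open[of "{s. Re s > 1}" "- {1}" g f])
        show "{s. Re s > 1} \<noteq> {}" by (auto intro!: exI[of _ 2])
        show "connected (- {1 :: complex})"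
          by (rule connected_punctured_universe) simp
      qed (use assms g False in \<open>auto simp: zeta_series_def open_halfspace_Re_gt\<close>)
    qed (use assms g in auto)
  qed
qed

text \<open>
  The two expressions agree on the strip \<open>-1 < Re s < 0\<close>, so together they define a
  holomorphic function on the plane punctured at \<open>1\<close> which extends the Dirichlet series.
\<close>
theorem zeta_functional_equation:
  assumes "Re s < 0"
  shows "riemann_zeta s = zeta_reflected s"
proof -
  define f where "f = (\<lambda>s. if s = 1 then 0 else if Re s > -1 then zeta_Mellin s else zeta_reflected s)"
  have left: "f s = zeta_reflected s" if "Re s < 0" for s
    using that zeta_Mellin_eq_reflected[of s] by (auto simp: f_def)
  have "f holomorphic_on ({s. Re s > -1} - {1}) \<union> {s. Re s < 0}"
  proof (rule holomorphic_on_Un)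
    show "f holomorphic_on {s. Re s > -1} - {1}"
      by (rule holomorphic_transform[OF zeta_Mellin_holomorphic]) (auto simp: f_def)
    show "f holomorphic_on {s. Re s < 0}"
      by (rule holomorphic_transform[OF zeta_reflected_holomorphic]) (auto simp: left)
  qed (auto intro!: open_halfspace_Re_gt open_halfspace_Re_lt open_delete)
  hence "f holomorphic_on - {1}"
    by (rule holomorphic_on_subset) auto
  hence "riemann_zeta = f"
    by (rule riemann_zeta_eqI) (auto simp: f_def zeta_Mellin_eq_series)
  with left[OF assms] show ?thesis by simp
qed

section \<open>Convexity estimates and a criterion for critical points\<close>

text \<open>
  This is \<open>x cot x \<le> 1 - x\<^sup>2/3\<close>, the first two terms of the Taylor series, multiplied by the
  positive number \<open>sin x\<close>. The difference of the two sides vanishes at \<open>0\<close> and has derivative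
  \<open>(x/3) (sin x - x cos x)\<close>, where the second factor in turn vanishes at \<open>0\<close> and has derivative
  \<open>x sin x\<close>.
\<close>
lemma x_cos_le_sin:
  fixes x :: real
  assumes "0 < x" "x < pi"
  shows "x * cos x \<le> (1 - x^2 / 3) * sin x"
proof -
  have sin_nonneg: "sin y \<ge> 0" if "0 \<le> y" "y \<le> x" for y
    using that assms by (intro sin_ge_zero) auto
  have 1: "sin y - y * cos y \<ge> 0" if "0 \<le> y" "y \<le> x" for y
  proof -
    have "sin 0 - 0 * cos 0 \<le> sin y - y * cos y"
    proof (rule DERIV_nonneg_imp_nondecreasing[OF that(1)])
      fix z assume "0 \<le> z" "z \<le> y"
      thus "\<exists>d. ((\<lambda>z. sin z - z * cos z) has_real_derivative d) (at z) \<and> 0 \<le> d"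
        using sin_nonneg[of z] that
        by (intro exI[of _ "z * sin z"]) (auto intro!: derivative_eq_intros)
    qed
    thus ?thesis by simp
  qed
  have "(1 - 0^2 / 3) * sin 0 - 0 * cos 0 \<le> (1 - x^2 / 3) * sin x - x * cos x"
  proof (rule DERIV_nonneg_imp_nondecreasing[where f = "\<lambda>z. (1 - z^2 / 3) * sin z - z * cos z"])
    fix z assume z: "0 \<le> z" "z \<le> x"
    have "((\<lambda>z. (1 - z^2 / 3) * sin z - z * cos z) has_real_derivative (z / 3) * (sin z - z * cos z)) (at z)"
      by (auto intro!: derivative_eq_intros simp: field_simps power2_eq_square)
    moreover have "0 \<le> (z / 3) * (sin z - z * cos z)" using 1[OF z] z by simp
    ultimately show "\<exists>d. ((\<lambda>z. (1 - z^2 / 3) * sin z - z * cos z) has_real_derivative d) (at z) \<and> 0 \<le> d"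
      by blast
  qed (use assms in auto)
  thus ?thesis by simp
qed

text \<open>
  As \<open>ln \<Gamma>\<close> is convex, its derivative at \<open>u\<close> is at least its slope over \<open>[u - 1, u]\<close>, which is
  \<open>ln (u - 1)\<close> by \<open>\<Gamma>(u) = (u - 1) \<Gamma>(u - 1)\<close>.
\<close>
lemma Digamma_real_ge_ln:
  fixes u :: real
  assumes "u > 1"
  shows "Digamma u \<ge> ln (u - 1)"
proof -
  have "(ln \<circ> Gamma) (u - 1) - (ln \<circ> Gamma) u \<ge> Digamma u * ((u - 1) - u)"
  proof (rule convex_on_imp_above_tangent[OF log_convex_Gamma_real])
    show "((ln \<circ> Gamma) has_real_derivative Digamma u) (at u within {0<..})"
      using assms Gamma_real_pos[of u] unfolding o_def
      by (auto intro!: derivative_eq_intros simp: less_imp_neq[symmetric] elim!: nonpos_Ints_cases)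
  qed (use assms in \<open>auto simp: interior_open\<close>)
  moreover have "Gamma u = (u - 1) * Gamma (u - 1)"
    using Gamma_plus1[of "u - 1"] assms nonpos_Ints_nonpos[of "u - 1"] by auto
  ultimately show ?thesis
    using assms less_imp_neq[OF Gamma_real_pos[of "u - 1"]] by (simp add: ln_mult)
qed

lemma zeta_real_ge_1: "u > 1 \<Longrightarrow> zeta_real u \<ge> 1"
  using sum_le_suminf[OF summable_zeta_real[of u], of "{0}"] by (simp add: zeta_real_def)

lemma zeta_real_2: "zeta_real 2 = pi^2 / 6"
proof -
  have "real (Suc k) powr - 2 = 1 / real ((k + 1)^2)" for k
  proof -
    have "real (Suc k) powr - 2 = inverse (real (Suc k) ^ 2)" by (simp only: powr_minus powr_numeral of_nat_0_le_iff)
    thus ?thesis by (simp only: Suc_eq_plus1 of_nat_power divide_inverse mult_1)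
  qed
  thus ?thesis using inverse_squares_sums unfolding zeta_real_def by (simp only: sums_iff)
qed

lemma convex_on_zeta_real: "convex_on {1<..} zeta_real"
proof (rule convex_onI)
  fix t x y :: real
  assume t: "0 < t" "t < 1" and xy: "x \<in> {1<..}" "y \<in> {1<..}"
  have z: "(1 - t) * x + t * y > 1"
  proof -
    have "(1 - t) * 1 + t * 1 < (1 - t) * x + t * y"
      using t xy by (intro add_strict_mono mult_strict_left_mono) auto
    thus ?thesis by simp
  qed
  have "real (Suc k) powr - ((1 - t) * x + t * y) \<le>
        (1 - t) * real (Suc k) powr - x + t * real (Suc k) powr - y" for k
  proof -
    have "exp ((1 - t) *\<^sub>R (- x * ln (real (Suc k))) + t *\<^sub>R (- y * ln (real (Suc k)))) \<le>
          (1 - t) * exp (- x * ln (real (Suc k))) + t * exp (- y * ln (real (Suc k)))"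
      by (rule convex_onD[OF exp_convex]) (use t in auto)
    thus ?thesis by (simp add: powr_def algebra_simps)
  qed
  hence "zeta_real ((1 - t) * x + t * y) \<le>
    (\<Sum>k. (1 - t) * real (Suc k) powr - x + t * real (Suc k) powr - y)"
    unfolding zeta_real_def using xy z
    by (intro suminf_le summable_add summable_mult summable_zeta_real) auto
  also have "\<dots> = (1 - t) * zeta_real x + t * zeta_real y"
    unfolding zeta_real_def using xy
    by (subst suminf_add [symmetric])
       (auto intro!: summable_mult summable_zeta_real simp: suminf_mult summable_zeta_real simp del: of_nat_Suc)
  finally show "zeta_real ((1 - t) *\<^sub>R x + t *\<^sub>R y) \<le> (1 - t) * zeta_real x + t * zeta_real y" by simp
qed auto

lemma zeta_real_differentiable:
  assumes "u > 1"
  shows "zeta_real field_differentiable at u"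
proof -
  have "(zeta_series has_field_derivative deriv zeta_series (of_real u)) (at (of_real u))"
    by (rule holomorphic_derivI[OF zeta_series_holomorphic open_halfspace_Re_gt]) (use assms in auto)
  from has_field_derivative_Re[OF has_vector_derivative_real_field[OF this]]
  have "((\<lambda>x. Re (zeta_series (of_real x))) has_real_derivative Re (deriv zeta_series (of_real u))) (at u)" .
  hence "(zeta_real has_real_derivative Re (deriv zeta_series (of_real u))) (at u)"
    by (rule has_field_derivative_transform_within_open[of _ _ _ "{1<..}"])
       (use assms in \<open>auto simp: zeta_series_of_real\<close>)
  thus ?thesis by (auto simp: field_differentiable_def)
qed

text \<open>
  The tangent to the convex function \<open>\<zeta>\<close> at \<open>u\<close> lies below the graph at the point \<open>2\<close>. This
  bounds \<open>-\<zeta>'(u)\<close> by the slope of a chord and avoids differentiating the series term by term.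
\<close>
lemma zeta_real_log_deriv_ge:
  assumes u: "u > 2"
  shows "deriv zeta_real u / zeta_real u \<ge> - ((pi^2 / 6 - 1) / (u - 2))"
proof -
  have z1: "zeta_real u \<ge> 1" using zeta_real_ge_1[of u] u by simp
  have "zeta_real 2 - zeta_real u \<ge> deriv zeta_real u * (2 - u)"
  proof (rule convex_on_imp_above_tangent[OF convex_on_zeta_real])
    show "(zeta_real has_real_derivative deriv zeta_real u) (at u within {1<..})"
      using zeta_real_differentiable[of u] u
      by (auto intro: has_field_derivative_at_within simp: field_differentiable_derivI)
  qed (use u in \<open>auto simp: interior_open\<close>)
  hence "- deriv zeta_real u * (u - 2) \<le> pi^2 / 6 - zeta_real u"
    by (simp add: zeta_real_2 algebra_simps)
  also have "\<dots> \<le> pi^2 / 6 - 1" using z1 by simp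
  finally have d: "- deriv zeta_real u \<le> (pi^2 / 6 - 1) / (u - 2)"
    using u by (simp only: pos_le_divide_eq diff_gt_0_iff_gt)
  define c where "c = (pi^2 / 6 - 1) / (u - 2)"
  have "1 \<le> pi^2 / 6" using zeta_real_ge_1[of 2] by (simp add: zeta_real_2)
  hence "c \<ge> 0" using u by (simp add: c_def)
  hence "c * 1 \<le> c * zeta_real u"
    using z1 by (intro mult_left_mono) auto
  with d have "- c * zeta_real u \<le> deriv zeta_real u" unfolding c_def[symmetric] by simp
  hence "- c \<le> deriv zeta_real u / zeta_real u"
    using z1 by (subst pos_le_divide_eq) auto
  thus ?thesis by (simp add: c_def)
qed

text \<open>
  The hypothesis \<open>end_le\<close> says that the derivative of \<open>sin (\<pi>t/2) A(t)\<close> is at most \<open>0\<close> at the right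
  end \<open>e\<close>. The product vanishes at \<open>0\<close> and is positive at \<open>e\<close>, so its maximum over \<open>[0, e]\<close> is not
  at \<open>0\<close>. Either the maximum is in the interior, or it is at \<open>e\<close>, where the derivative cannot
  be negative and hence is zero.
\<close>
lemma critical_point_sin_times_positive:
  fixes A q :: "real \<Rightarrow> real" and e :: real
  assumes e: "0 < e" "e < 2"
    and A: "\<And>t. t \<in> {0..e} \<Longrightarrow> (A has_real_derivative A t * q t) (at t)"
    and pos: "\<And>t. t \<in> {0..e} \<Longrightarrow> A t > 0"
    and end_le: "(pi / 2) * cos (pi * e / 2) + q e * sin (pi * e / 2) \<le> 0"
  shows "\<exists>t\<in>{0..e}. ((\<lambda>t. sin (pi * t / 2) * A t) has_real_derivative 0) (at t)"
proof -
  define G where "G = (\<lambda>t. sin (pi * t / 2) * A t)"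
  define G' where "G' = (\<lambda>t. A t * ((pi / 2) * cos (pi * t / 2) + q t * sin (pi * t / 2)))"
  have G: "(G has_real_derivative G' t) (at t)" if "t \<in> {0..e}" for t
  proof -
    have "((\<lambda>t. sin (pi * t / 2)) has_real_derivative cos (pi * t / 2) * (pi / 2)) (at t)"
      by (auto intro!: derivative_eq_intros)
    from DERIV_mult[OF this A[OF that]] show ?thesis
      unfolding G_def G'_def by (simp add: algebra_simps)
  qed
  have sin_pos: "sin (pi * t / 2) > 0" if "0 < t" "t \<le> e" for t
    using that e by (intro sin_gt_zero) auto
  have "continuous_on {0..e} G"
    using G by (intro continuous_at_imp_continuous_on) (blast intro: DERIV_isCont)
  then obtain t where t: "t \<in> {0..e}" "\<And>y. y \<in> {0..e} \<Longrightarrow> G y \<le> G t"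
    using continuous_attains_sup[of "{0..e}" G] e by auto
  have "G 0 = 0" by (simp add: G_def)
  moreover have "G e > 0" using sin_pos[of e] pos[of e] e by (simp add: G_def)
  ultimately have "t > 0" using t(2)[of e] t(1) e by (cases "t = 0") auto
  show ?thesis
  proof (cases "t = e")
    case False
    have "G' t = 0"
    proof (rule DERIV_local_max[OF G[OF t(1)]])
      show "0 < min t (e - t)" using \<open>t > 0\<close> False t(1) by auto
      show "\<forall>y. \<bar>t - y\<bar> < min t (e - t) \<longrightarrow> G y \<le> G t"
        by (intro allI impI t(2)) (auto simp: abs_less_iff)
    qed
    thus ?thesis using G[OF t(1)] t(1) unfolding G_def by auto
  next
    case True
    have "G' e \<le> 0" unfolding G'_def using end_le pos[of e] e
      by (intro mult_nonneg_nonpos) auto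
    moreover have "\<not> G' e < 0"
    proof
      assume "G' e < 0"
      then obtain d where d: "d > 0" "\<And>h. 0 < h \<Longrightarrow> h < d \<Longrightarrow> G e < G (e - h)"
        using DERIV_neg_dec_left[OF G[of e]] e by auto
      define h where "h = min (d / 2) e"
      have "0 < h" "h < d" "h \<le> e" using d(1) e by (auto simp: h_def)
      thus False using d(2)[of h] t(2)[of "e - h"] True by auto
    qed
    ultimately show ?thesis using G[of e] e unfolding G_def by (intro bexI[of _ e]) auto
  qed
qed

section \<open>The eta function on the negative axis\<close>

text \<open>
  By the functional equation, \<open>\<eta>(x) = - sin (\<pi>x/2) * eta_factor (1 - x)\<close> for \<open>x < 0\<close>.
\<close>
definition eta_factor :: "real \<Rightarrow> real" where
  "eta_factor u = 2 * (2 powr u - 1) * (2 * pi) powr (- u) * Gamma u * zeta_real u"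

lemma eta_factor_pos: "u > 1 \<Longrightarrow> eta_factor u > 0"
  unfolding eta_factor_def using zeta_real_ge_1[of u] powr_less_mono[of 0 u 2]
  by (intro mult_pos_pos Gamma_real_pos) auto

text \<open>
  The second factor is the sum of the logarithmic derivatives of the factors.
\<close>
lemma eta_factor_deriv:
  assumes u: "u > 1"
  shows "(eta_factor has_real_derivative eta_factor u *
           (ln 2 * 2 powr u / (2 powr u - 1) - ln (2 * pi) + Digamma u + deriv zeta_real u / zeta_real u)) (at u)"
proof -
  have 2: "2 powr u - 1 > 0" using powr_less_mono[of 0 u 2] u by simp
  have z: "zeta_real u > 0" using zeta_real_ge_1[OF u] by simp
  have u': "u \<notin> \<int>\<^sub>\<le>\<^sub>0" using u by (auto elim!: nonpos_Ints_cases)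
  have dz: "(zeta_real has_real_derivative deriv zeta_real u) (at u)"
    using zeta_real_differentiable[OF u] by (simp add: field_differentiable_derivI)
  have d1: "((\<lambda>u. 2 powr u - 1) has_real_derivative (2 powr u - 1) * (ln 2 * 2 powr u / (2 powr u - 1))) (at u)"
    using 2 by (auto intro!: derivative_eq_intros)
  have d2: "((\<lambda>u. (2 * pi) powr (- u)) has_real_derivative (2 * pi) powr (-u) * (- ln (2 * pi))) (at u)"
    by (auto intro!: derivative_eq_intros)
  have dG: "(Gamma has_real_derivative Gamma u * Digamma u) (at u)"
    using u' by (auto intro!: derivative_eq_intros)
  have dz': "(zeta_real has_real_derivative zeta_real u * (deriv zeta_real u / zeta_real u)) (at u)"
    using dz z by simp
  have d1': "((\<lambda>u. 2 * (2 powr u - 1)) has_real_derivative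
      2 * (2 powr u - 1) * (ln 2 * 2 powr u / (2 powr u - 1))) (at u)"
    using DERIV_cmult[OF d1, of 2] by (simp only: mult.assoc)
  have prod: "((\<lambda>u. f u * g u) has_real_derivative (f u * g u) * (a + b)) (at u)"
    if "(f has_real_derivative f u * a) (at u)" "(g has_real_derivative g u * b) (at u)" for f g a b
    using DERIV_mult[OF that] by (simp add: algebra_simps)
  from prod[OF prod[OF prod[OF d1' d2] dG] dz'] show ?thesis
    unfolding eta_factor_def by simp
qed

lemma dirichlet_eta_left:
  assumes "Re s < 0"
  shows "dirichlet_eta s = (1 - 2 powr (1 - s)) * zeta_reflected s"
  using assms zeta_functional_equation[OF assms] by (simp add: dirichlet_eta_def)

lemma dirichlet_eta_of_real:
  assumes "x < 0"
  shows "dirichlet_eta (of_real x) = of_real (- sin (pi * x / 2) * eta_factor (1 - x))"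
proof -
  have "- sin (pi * x / 2) * eta_factor (1 - x) = (1 - 2 powr (1 - x)) *
     (2 * (2 * pi) powr (x - 1) * sin (pi * x / 2) * Gamma (1 - x) * zeta_real (1 - x))"
    by (simp add: eta_factor_def algebra_simps)
  also have "complex_of_real \<dots> = dirichlet_eta (of_real x)"
    using zeta_series_of_real[of "1 - x"] powr_of_real[of "2 * pi" "x - 1"] Gamma_complex_of_real[of "1 - x"]
      sin_of_real[of "pi * x / 2", where 'a = complex] powr_of_real[of 2 "1 - x"] assms
    by (simp add: dirichlet_eta_left zeta_reflected_def)
  finally show ?thesis ..
qed

text \<open>
  A holomorphic function that is real on the real axis may be differentiated along the axis, so
  the complex derivative at a negative real point can be read off from the real formula.
\<close>
lemma deriv_dirichlet_eta_eq_0I: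
  assumes "x < 0" and "((\<lambda>y. sin (pi * y / 2) * eta_factor (1 - y)) has_real_derivative 0) (at x)"
  shows "deriv dirichlet_eta (of_real x) = 0"
proof -
  have "(\<lambda>s. (1 - 2 powr (1 - s)) * zeta_reflected s) holomorphic_on {s. Re s < 0}"
    by (intro holomorphic_intros zeta_reflected_holomorphic)
  hence "dirichlet_eta holomorphic_on {s. Re s < 0}"
    by (rule holomorphic_transform) (simp add: dirichlet_eta_left)
  hence "(dirichlet_eta has_field_derivative deriv dirichlet_eta (of_real x)) (at (of_real x))"
    using assms(1) by (intro holomorphic_derivI[OF _ open_halfspace_Re_lt[of 0]]) auto
  hence "((\<lambda>y. dirichlet_eta (of_real y)) has_vector_derivative deriv dirichlet_eta (of_real x)) (at x)"
    by (rule has_vector_derivative_real_field)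
  moreover have "((\<lambda>y. dirichlet_eta (of_real y)) has_vector_derivative 0) (at x)"
  proof (rule has_vector_derivative_transform_within_open[of _ _ _ "{..<0}"])
    have "((\<lambda>y. - (sin (pi * y / 2) * eta_factor (1 - y))) has_real_derivative 0) (at x)"
      using DERIV_minus[OF assms(2)] by simp
    from has_vector_derivative_of_real[OF this]
    show "((\<lambda>y. complex_of_real (- sin (pi * y / 2) * eta_factor (1 - y))) has_vector_derivative 0) (at x)"
      by simp
  qed (use assms(1) in \<open>auto simp: dirichlet_eta_of_real\<close>)
  ultimately show ?thesis by (rule vector_derivative_unique_at)
qed

section \<open>The critical point near a trivial zero\<close>

theorem theorem5p1:
  fixes n :: nat and \<tau> :: real
  assumes "n \<ge> 3"
    and "\<tau> = 2 / 3 * ln 2 - ln (2 * pi) - 1 / 6 - 1 / 81 - 1 / 2"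
  shows "\<exists>\<epsilon> \<sigma> :: real.
    0 \<le> \<epsilon> \<and>
    \<epsilon> \<le> - (6 / pi\<^sup>2) * (ln (2 * real n + 2) + \<tau>)
        + 6 / pi\<^sup>2 * sqrt ((ln (2 * real n + 2) + \<tau>)\<^sup>2 + pi\<^sup>2 / 3) \<and>
    \<sigma> \<in> {- 2 * real n - 2 .. - 2 * real n - 2 + \<epsilon>} \<and>
    deriv dirichlet_eta (complex_of_real \<sigma>) = 0"
proof -
  define N where "N = 2 * real n + 2"
  define L where "L = ln N + \<tau>"
  define w where "w = sqrt (L^2 + pi^2 / 3)"
  define e where "e = 6 / pi^2 * (w - L)"
  have N: "N \<ge> 8" using assms(1) by (simp add: N_def)
  have pi: "3 < pi" "pi < 3.2" using pi_approx by auto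
  have pi2: "9 < pi^2" "pi^2 < 10.24"
    using power_strict_mono[OF pi(1), of 2] power_strict_mono[OF pi(2), of 2] by (simp_all add: power2_eq_square)
  have L_gt: "L > -7/10"
  proof -
    have "ln (2 * pi) \<le> ln N" using pi N by (subst ln_le_cancel_iff) auto
    moreover have "ln (2::real) > 0" by simp
    ultimately show ?thesis unfolding L_def assms(2) by linarith
  qed
  have w2: "w^2 = L^2 + pi^2 / 3" by (simp add: w_def)
  have "\<bar>L\<bar> < w" unfolding w_def by (rule real_less_rsqrt) (use pi in auto)
  hence e_pos: "e > 0" by (simp add: e_def)
  \<comment> \<open>\<open>e\<close> is the positive root of this quadratic equation, and equals the bound in the theorem.\<close>
  have e_quad: "e * (pi^2 * e / 12 + L) = 1"
  proof -
    have "pi^2 * e / 12 + L = (w + L) / 2" by (simp add: e_def field_simps)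
    hence "e * (pi^2 * e / 12 + L) = 3 / pi^2 * (w^2 - L^2)"
      by (simp add: e_def field_simps power2_eq_square)
    thus ?thesis by (simp add: w2)
  qed
  \<comment> \<open>For \<open>e \<ge> 2\<close> and \<open>L > -7/10\<close> the left-hand side of \<open>e_quad\<close> would exceed \<open>1\<close>. The bound \<open>2\<close>
    keeps \<open>sin (\<pi>t/2)\<close> positive and \<open>u = N + 1 - e\<close> above \<open>7\<close>.\<close>
  have e_lt: "e < 2"
  proof (rule ccontr)
    assume "\<not> e < 2"
    hence "9 * 2 \<le> pi^2 * e" using pi2 by (intro mult_mono) auto
    hence "1/2 < pi^2 * e / 12 + L" using L_gt by linarith
    hence "2 * (1/2) < e * (pi^2 * e / 12 + L)"
      using \<open>\<not> e < 2\<close> by (intro mult_le_less_imp_less) auto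
    thus False using e_quad by simp
  qed

  define q where "q = (\<lambda>u. ln 2 * 2 powr u / (2 powr u - 1) - ln (2 * pi) + Digamma u +
                               deriv zeta_real u / zeta_real u)"
  define A where "A = (\<lambda>t. eta_factor (N + 1 - t))"
  have A: "(A has_real_derivative A t * (- q (N + 1 - t))) (at t)" if "t \<in> {0..e}" for t
  proof -
    have "N + 1 - t > 1" using that e_lt N by auto
    hence outer: "(eta_factor has_real_derivative eta_factor (N + 1 - t) * q (N + 1 - t)) (at (N + 1 - t))"
      unfolding q_def by (rule eta_factor_deriv)
    have inner: "((\<lambda>t. N + 1 - t) has_real_derivative - 1) (at t)"
      by (auto intro!: derivative_eq_intros)
    from DERIV_chain'[OF inner outer] show ?thesis by (simp add: A_def)
  qed
  have A_pos: "A t > 0" if "t \<in> {0..e}" for t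
    unfolding A_def using that e_lt N by (intro eta_factor_pos) auto

  \<comment> \<open>After cancelling \<open>ln N\<close> and \<open>ln (2 \<pi>)\<close> this reads, up to the errors estimated below,
    \<open>ln 2 - 1/3 - 1/5 \<ge> (2/3) ln 2 - 55/81\<close>, which holds since \<open>1/3 + 1/5 < 55/81\<close>.\<close>
  have q_ge: "q (N + 1 - e) \<ge> L"
  proof -
    define u where "u = N + 1 - e"
    have u: "u > N - 1" "u > 7" using e_lt N by (auto simp: u_def)
    have "2 powr u - 1 > 0" using powr_less_mono[of 0 u 2] u by simp
    hence "ln 2 \<le> ln 2 * 2 powr u / (2 powr u - 1)" by (simp add: field_simps)
    moreover have "ln (N - 2) \<le> Digamma u"
    proof -
      have "ln (N - 2) \<le> ln (u - 1)" using u N by (subst ln_le_cancel_iff) auto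
      thus ?thesis using Digamma_real_ge_ln[of u] u by simp
    qed
    moreover have "ln N - ln (N - 2) \<le> 1 / 3"
    proof -
      have "ln N - ln (N - 2) = ln (N / (N - 2))" using N by (simp add: ln_div)
      also have "\<dots> \<le> N / (N - 2) - 1" using N by (intro ln_le_minus_one) auto
      also have "\<dots> \<le> 1 / 3" using N by (simp add: field_simps)
      finally show ?thesis .
    qed
    moreover have "deriv zeta_real u / zeta_real u \<ge> - (1 / 5)"
    proof -
      have "(pi^2 / 6 - 1) / (u - 2) \<le> 1 / 5"
        using pi2 u by (intro frac_le) auto
      moreover have "- ((pi^2 / 6 - 1) / (u - 2)) \<le> deriv zeta_real u / zeta_real u"
        using u by (intro zeta_real_log_deriv_ge) auto
      ultimately show ?thesis by linarith
    qed
    moreover have "ln (2::real) > 0" by simp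
    ultimately show ?thesis
      unfolding q_def L_def assms(2) u_def[symmetric] by linarith
  qed

  have "(pi / 2) * cos (pi * e / 2) + - q (N + 1 - e) * sin (pi * e / 2) \<le> 0"
  proof -
    have s: "sin (pi * e / 2) > 0" using e_pos e_lt by (intro sin_gt_zero) auto
    have "(pi * e / 2) * cos (pi * e / 2) \<le> (1 - (pi * e / 2)^2 / 3) * sin (pi * e / 2)"
      using e_pos e_lt by (intro x_cos_le_sin) auto
    also have "1 - (pi * e / 2)^2 / 3 = e * L"
      using e_quad by (simp add: algebra_simps power2_eq_square)
    finally have "e * ((pi / 2) * cos (pi * e / 2)) \<le> e * (L * sin (pi * e / 2))"
      by (simp add: algebra_simps)
    hence "(pi / 2) * cos (pi * e / 2) \<le> L * sin (pi * e / 2)" using e_pos by simp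
    also have "\<dots> \<le> q (N + 1 - e) * sin (pi * e / 2)" using q_ge s by simp
    finally show ?thesis by simp
  qed
  then obtain t where t: "t \<in> {0..e}" "((\<lambda>t. sin (pi * t / 2) * A t) has_real_derivative 0) (at t)"
    using critical_point_sin_times_positive[OF e_pos e_lt A A_pos] by blast

  define \<sigma> where "\<sigma> = t - N"
  \<comment> \<open>The shift by \<open>N\<close> moves the argument of the sine by \<open>(n + 1) \<pi>\<close>, which only changes its sign.\<close>
  have shift: "sin (pi * y / 2) * eta_factor (1 - y) = (-1) ^ (n + 1) * (sin (pi * (y + N) / 2) * A (y + N))" for y
  proof -
    have "pi * y / 2 = pi * (y + N) / 2 - real (n + 1) * pi" by (simp add: N_def field_simps)
    hence "sin (pi * y / 2) = (-1) ^ (n + 1) * sin (pi * (y + N) / 2)"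
      by (simp only: sin_diff sin_npi cos_npi) simp
    thus ?thesis by (simp add: A_def)
  qed
  have "((\<lambda>y. sin (pi * (y + N) / 2) * A (y + N)) has_real_derivative 0) (at \<sigma>)"
    using t(2) DERIV_shift[of "\<lambda>t. sin (pi * t / 2) * A t" 0 \<sigma> N] by (simp add: \<sigma>_def)
  from DERIV_cmult[OF this, of "(-1) ^ (n + 1)"]
  have "((\<lambda>y. sin (pi * y / 2) * eta_factor (1 - y)) has_real_derivative 0) (at \<sigma>)"
    unfolding shift by simp
  hence "deriv dirichlet_eta (of_real \<sigma>) = 0"
    using t(1) e_lt N by (intro deriv_dirichlet_eta_eq_0I) (auto simp: \<sigma>_def)
  moreover have "\<sigma> \<in> {- 2 * real n - 2 .. - 2 * real n - 2 + e}"
    using t(1) by (auto simp: \<sigma>_def N_def)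
  moreover have "e = - (6 / pi\<^sup>2) * (ln (2 * real n + 2) + \<tau>)
        + 6 / pi\<^sup>2 * sqrt ((ln (2 * real n + 2) + \<tau>)\<^sup>2 + pi\<^sup>2 / 3)"
    by (simp add: e_def w_def L_def N_def algebra_simps)
  ultimately show ?thesis using e_pos by (intro exI[of _ e] exI[of _ \<sigma>]) auto
qed

end
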